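(* For each $t\in[0,1)$ the operator $C_t$ maps $A(\mathbb{D})$ into itself and $C_t\colon A(\mathbb{D})\to A(\mathbb{D})$ is continuous. Moreover, the operator norms are given by $\|C_0\|_{A(\mathbb{D})\to A(\mathbb{D})}=1$ and $$\|C_t\|_{A(\mathbb{D})\to A(\mathbb{D})}=\frac{-\log(1-t)}{t},\quad t\in(0,1).$$
   Context: Let $\mathbb{D}=\{z\in\mathbb{C}:|z|<1\}$ and let $H(\mathbb{D})$ be the space of holomorphic functions on $\mathbb{D}$. The disc algebra $A(\mathbb{D})$ consists of all $f\in H(\mathbb{D})$ that extend to a continuous function on $\overline{\mathbb{D}}$; it is a Banach space with the norm $\|f\|_\infty=\sup_{z\in\mathbb{D}}|f(z)|$. For $t\in[0,1)$ the generalized Cesàro operator $C_t\colon H(\mathbb{D})\to H(\mathbb{D})$ is defined by $(C_tf)(0):=f(0)$ and $(C_tf)(z):=\frac1z\int_0^z\frac{f(\xi)}{1-t\xi}\,d\xi$ for $z\in\mathbb{D}\setminus\{0\}$. *)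

theory Defs
  imports "HOL-Complex_Analysis.Complex_Analysis"
begin

section \<open>The disc algebra as a Banach space\<close>

text \<open>
  HOL functions are total, so a function on the open unit disc is represented by the total
  function that vanishes outside it.  This makes the representation unique: two elements
  of \<open>disc_algebra\<close> are equal iff they agree on the disc.
\<close>

definition disc_algebra :: "(complex \<Rightarrow> complex) set" where
  "disc_algebra = {f. f holomorphic_on ball 0 1 \<and>
     (\<exists>g. continuous_on (cball 0 1) g \<and> (\<forall>z\<in>ball 0 1. g z = f z)) \<and>
     (\<forall>z. z \<notin> ball 0 1 \<longrightarrow> f z = 0)}"

lemma disc_algebra_const: "(\<lambda>z. if z \<in> ball 0 1 then c else 0) \<in> disc_algebra"
proof -
  have "(\<lambda>z::complex. if z \<in> ball 0 1 then c else 0) holomorphic_on ball 0 1"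
    by (rule holomorphic_transform[of "\<lambda>_. c"]) auto
  then show ?thesis
    unfolding disc_algebra_def by (auto intro!: exI[of _ "\<lambda>_. c"])
qed

lemma disc_algebra_add:
  assumes "f \<in> disc_algebra" "g \<in> disc_algebra"
  shows "(\<lambda>z. f z + g z) \<in> disc_algebra"
proof -
  obtain f' g' where "continuous_on (cball 0 1) f'" "\<forall>z\<in>ball 0 1. f' z = f z"
    "continuous_on (cball 0 1) g'" "\<forall>z\<in>ball 0 1. g' z = g z"
    using assms unfolding disc_algebra_def by blast
  then have "\<exists>h. continuous_on (cball 0 1) h \<and> (\<forall>z\<in>ball 0 1. h z = f z + g z)"
    by (intro exI[of _ "\<lambda>z. f' z + g' z"]) (auto intro: continuous_intros)
  with assms show ?thesis
    unfolding disc_algebra_def by (auto intro: holomorphic_intros)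
qed

lemma disc_algebra_cmult:
  assumes "f \<in> disc_algebra"
  shows "(\<lambda>z. c * f z) \<in> disc_algebra"
proof -
  obtain f' where "continuous_on (cball 0 1) f'" "\<forall>z\<in>ball 0 1. f' z = f z"
    using assms unfolding disc_algebra_def by blast
  then have "\<exists>h. continuous_on (cball 0 1) h \<and> (\<forall>z\<in>ball 0 1. h z = c * f z)"
    by (intro exI[of _ "\<lambda>z. c * f' z"]) (auto intro: continuous_intros)
  with assms show ?thesis
    unfolding disc_algebra_def by (auto intro: holomorphic_intros)
qed

lemma disc_algebra_bounded:
  assumes "f \<in> disc_algebra"
  shows "bounded (f ` ball 0 1)"
proof -
  obtain f' where f': "continuous_on (cball 0 1) f'" "\<forall>z\<in>ball 0 1. f' z = f z"
    using assms unfolding disc_algebra_def by blast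
  have "bounded (f' ` cball 0 1)"
    using f' compact_continuous_image compact_cball compact_imp_bounded by blast
  then show ?thesis
  proof (rule bounded_subset)
    have "f ` ball 0 1 = f' ` ball 0 1"
      using f'(2) by (intro image_cong) auto
    then show "f ` ball 0 1 \<subseteq> f' ` cball 0 1"
      using image_mono[OF ball_subset_cball] by metis
  qed
qed

typedef disc_alg = disc_algebra
  morphisms apply_disc Disc
  using disc_algebra_const by blast

setup_lifting type_definition_disc_alg

instantiation disc_alg :: real_normed_vector
begin

lift_definition zero_disc_alg :: disc_alg is "\<lambda>_. 0"
  using disc_algebra_const[of 0] by simp

lift_definition plus_disc_alg :: "disc_alg \<Rightarrow> disc_alg \<Rightarrow> disc_alg" is "\<lambda>f g z. f z + g z"
  by (rule disc_algebra_add)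

lift_definition uminus_disc_alg :: "disc_alg \<Rightarrow> disc_alg" is "\<lambda>f z. - f z"
  using disc_algebra_cmult[of _ "-1"] by simp

lift_definition minus_disc_alg :: "disc_alg \<Rightarrow> disc_alg \<Rightarrow> disc_alg" is "\<lambda>f g z. f z - g z"
  subgoal for f g
    using disc_algebra_add[of f "\<lambda>z. - 1 * g z"] disc_algebra_cmult[of g "-1"] by simp
  done

lift_definition scaleR_disc_alg :: "real \<Rightarrow> disc_alg \<Rightarrow> disc_alg" is "\<lambda>r f z. r *\<^sub>R f z"
  subgoal for r f
    using disc_algebra_cmult[of f "of_real r"] by (simp add: scaleR_conv_of_real)
  done

definition norm_disc_alg :: "disc_alg \<Rightarrow> real" where
  "norm_disc_alg f = (SUP z\<in>ball 0 1. norm (apply_disc f z))"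

definition sgn_disc_alg :: "disc_alg \<Rightarrow> disc_alg" where
  "sgn_disc_alg f = inverse (norm f) *\<^sub>R f"

definition dist_disc_alg :: "disc_alg \<Rightarrow> disc_alg \<Rightarrow> real" where
  "dist_disc_alg f g = norm (f - g)"

definition uniformity_disc_alg :: "(disc_alg \<times> disc_alg) filter" where
  "uniformity_disc_alg = (INF e\<in>{0 <..}. principal {(x, y). dist x y < e})"

definition open_disc_alg :: "disc_alg set \<Rightarrow> bool" where
  "open_disc_alg S = (\<forall>x\<in>S. \<forall>\<^sub>F (x', y) in uniformity. x' = x \<longrightarrow> y \<in> S)"

lemma norm_apply_disc_le: "norm (apply_disc f z) \<le> norm f"
proof -
  have bdd: "bdd_above ((\<lambda>z. norm (apply_disc f z)) ` ball 0 1)"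
    using disc_algebra_bounded[OF apply_disc[of f]]
    by (auto simp: bounded_iff bdd_above_def)
  have le: "norm (apply_disc f w) \<le> norm f" if "w \<in> ball 0 1" for w
    unfolding norm_disc_alg_def using bdd that by (intro cSUP_upper)
  show ?thesis
  proof (cases "z \<in> ball 0 1")
    case False
    then have "apply_disc f z = 0"
      using apply_disc[of f] by (auto simp: disc_algebra_def)
    moreover have "0 \<le> norm f"
      using order_trans[OF norm_ge_zero le[of 0]] by simp
    ultimately show ?thesis by simp
  qed (use le in auto)
qed

lemma norm_disc_alg_le:
  assumes "\<And>z. z \<in> ball 0 1 \<Longrightarrow> norm (apply_disc f z) \<le> b"
  shows "norm f \<le> b"
  unfolding norm_disc_alg_def using assms by (intro cSUP_least) auto

instance
proof
  fix f g h :: disc_alg and a b :: real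
  show "f + g + h = f + (g + h)" "f + g = g + f" "0 + f = f" "- f + f = 0" "f - g = f + - g"
    by (transfer; auto simp: add.assoc add.commute)+
  show "a *\<^sub>R (f + g) = a *\<^sub>R f + a *\<^sub>R g" "(a + b) *\<^sub>R f = a *\<^sub>R f + b *\<^sub>R f"
    "a *\<^sub>R b *\<^sub>R f = (a * b) *\<^sub>R f" "1 *\<^sub>R f = f"
    by (transfer; simp add: scaleR_add_left scaleR_add_right)+
  show "dist f g = norm (f - g)" by (rule dist_disc_alg_def)
  show "sgn f = inverse (norm f) *\<^sub>R f" by (rule sgn_disc_alg_def)
  show "norm f = 0 \<longleftrightarrow> f = 0"
  proof
    assume "norm f = 0"
    then have "apply_disc f z = 0" for z
      using norm_apply_disc_le[of f z] by simp
    then show "f = 0" by transfer auto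
  next
    assume "f = 0"
    then show "norm f = 0" by (simp add: norm_disc_alg_def zero_disc_alg.rep_eq)
  qed
  show "norm (f + g) \<le> norm f + norm g"
    by (rule norm_disc_alg_le)
      (auto simp: plus_disc_alg.rep_eq intro!: norm_triangle_le add_mono norm_apply_disc_le)
  have le: "norm (c *\<^sub>R k) \<le> \<bar>c\<bar> * norm k" for c and k :: disc_alg
    by (rule norm_disc_alg_le) (simp add: scaleR_disc_alg.rep_eq mult_left_mono norm_apply_disc_le)
  show "norm (a *\<^sub>R f) = \<bar>a\<bar> * norm f"
  proof (cases "a = 0")
    case True
    then show ?thesis
      by (simp add: norm_disc_alg_def scaleR_disc_alg.rep_eq)
  next
    case False
    have "inverse a *\<^sub>R a *\<^sub>R f = f"
      using False by transfer simp
    then have "norm f \<le> \<bar>inverse a\<bar> * norm (a *\<^sub>R f)"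
      using le[of "inverse a" "a *\<^sub>R f"] by simp
    then have "\<bar>a\<bar> * norm f \<le> norm (a *\<^sub>R f)"
      using False by (simp add: field_simps)
    with le[of a f] show ?thesis by simp
  qed
qed (rule open_disc_alg_def uniformity_disc_alg_def)+

end

instance disc_alg :: banach
proof
  fix X :: "nat \<Rightarrow> disc_alg"
  assume X: "Cauchy X"
  let ?F = "\<lambda>n. apply_disc (X n)"
  have dle: "dist (apply_disc f z) (apply_disc g z) \<le> dist f g" for f g z
    using norm_apply_disc_le[of "f - g" z] by (simp add: minus_disc_alg.rep_eq dist_norm)
  have "\<exists>G. continuous_on (cball 0 1) G \<and> (\<forall>z\<in>ball 0 1. G z = ?F n z)" for n
    using apply_disc[of "X n"] by (auto simp: disc_algebra_def)
  then obtain G where G: "\<And>n. continuous_on (cball 0 1) (G n)"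
    "\<And>n z. z \<in> ball 0 1 \<Longrightarrow> G n z = ?F n z"
    by metis
  have holG: "G n holomorphic_on ball 0 1" for n
    by (rule holomorphic_transform[of "?F n"])
      (use apply_disc[of "X n"] G(2) in \<open>auto simp: disc_algebra_def\<close>)
  have G_le: "dist (G m z) (G n z) \<le> dist (X m) (X n)" if z: "z \<in> cball 0 1" for m n z
  proof -
    have "norm (G m z - G n z) \<le> dist (X m) (X n)"
    proof (rule continuous_on_closure_norm_le[where s = "ball 0 1" and f = "\<lambda>z. G m z - G n z"])
      show "continuous_on (closure (ball 0 1)) (\<lambda>z. G m z - G n z)"
        using G(1) by (auto intro: continuous_intros)
      show "\<forall>y\<in>ball 0 1. norm (G m y - G n y) \<le> dist (X m) (X n)"
        using dle G(2) by (simp add: dist_norm)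
      show "z \<in> closure (ball 0 1)" using z by simp
    qed
    then show ?thesis by (simp add: dist_norm)
  qed
  have "uniformly_Cauchy_on (cball 0 1) G"
  proof (rule uniformly_Cauchy_onI)
    fix e :: real assume "e > 0"
    show "\<exists>M. \<forall>x\<in>cball 0 1. \<forall>m\<ge>M. \<forall>n\<ge>M. dist (G m x) (G n x) < e"
    proof -
      obtain M where M: "\<And>m n. m \<ge> M \<Longrightarrow> n \<ge> M \<Longrightarrow> dist (X m) (X n) < e"
        using X \<open>e > 0\<close> unfolding Cauchy_def by blast
      show ?thesis
        using G_le M by (intro exI[of _ M]) (blast intro: le_less_trans)
    qed
  qed
  then obtain L where L: "uniform_limit (cball 0 1) G L sequentially"
    using Cauchy_uniformly_convergent uniformly_convergent_on_def by blast
  obtain contL: "continuous_on (cball 0 1) L" and holL: "L holomorphic_on ball 0 1"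
    by (rule holomorphic_uniform_limit[OF _ L]) (use G(1) holG in auto)
  define l where "l z = (if z \<in> ball 0 1 then L z else 0)" for z
  have "l holomorphic_on ball 0 1"
    by (rule holomorphic_transform[OF holL]) (auto simp: l_def)
  then have l_in: "l \<in> disc_algebra"
    using contL by (auto simp: disc_algebra_def l_def)
  have "X \<longlonglongrightarrow> Disc l"
  proof (rule tendstoI)
    fix e :: real assume "e > 0"
    then have "\<forall>\<^sub>F n in sequentially. \<forall>z\<in>cball 0 1. dist (G n z) (L z) < e / 2"
      using L by (intro uniform_limitD) auto
    then show "\<forall>\<^sub>F n in sequentially. dist (X n) (Disc l) < e"
    proof eventually_elim
      case (elim n)
      have "norm (X n - Disc l) \<le> e / 2"
      proof (rule norm_disc_alg_le)
        fix z :: complex assume z: "z \<in> ball 0 1"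
        then have "dist (G n z) (L z) < e / 2" using elim by simp
        then show "norm (apply_disc (X n - Disc l) z) \<le> e / 2"
          using z G(2)[OF z, of n]
          by (simp add: minus_disc_alg.rep_eq Disc_inverse[OF l_in] l_def dist_norm)
      qed
      with \<open>e > 0\<close> show ?case by (simp add: dist_norm)
    qed
  qed
  then show "convergent X" by (rule convergentI)
qed


section \<open>Generalized Cesaro operators\<close>

text \<open>
  For holomorphic \<open>f\<close> and \<open>0 \<le> t < 1\<close> the integrand is holomorphic on the (convex) disc, so the
  integral does not depend on the path from 0 to \<open>z\<close>; we take the straight segment.
  The value 0 outside the disc follows the convention of \<open>disc_algebra\<close>.
\<close>

definition cesaro :: "real \<Rightarrow> (complex \<Rightarrow> complex) \<Rightarrow> complex \<Rightarrow> complex" where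
  "cesaro t f z =
     (if z \<notin> ball 0 1 then 0
      else if z = 0 then f 0
      else 1 / z * contour_integral (linepath 0 z) (\<lambda>\<xi>. f \<xi> / (1 - of_real t * \<xi>)))"

text \<open>
  The operator induced on the Banach space; it is meaningful only because \<open>cesaro t\<close> maps
  \<open>disc_algebra\<close> into itself, as \<open>Disc\<close> is unspecified elsewhere.
\<close>

definition cesaro_disc :: "real \<Rightarrow> disc_alg \<Rightarrow> disc_alg" where
  "cesaro_disc t f = Disc (cesaro t (apply_disc f))"

lemma cesaro_integrable:
  assumes t: "0 \<le> t" "t < 1" and f: "f holomorphic_on ball 0 1" and z: "z \<in> ball 0 1"
  shows "(\<lambda>\<xi>. f \<xi> / (1 - of_real t * \<xi>)) contour_integrable_on linepath 0 z"
proof (rule contour_integrable_continuous_linepath)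
  have sub: "closed_segment 0 z \<subseteq> ball 0 1"
    using z by (intro closed_segment_subset) auto
  have "1 - of_real t * \<xi> \<noteq> 0" if "\<xi> \<in> ball 0 1" for \<xi> :: complex
  proof
    assume "1 - of_real t * \<xi> = 0"
    then have "norm (of_real t * \<xi>) = 1" by simp
    then have "t * norm \<xi> = 1" using t by (simp add: norm_mult)
    moreover have "t * norm \<xi> \<le> 1 * norm \<xi>"
      using t by (intro mult_right_mono) auto
    ultimately show False using that by simp
  qed
  then show "continuous_on (closed_segment 0 z) (\<lambda>\<xi>. f \<xi> / (1 - of_real t * \<xi>))"
    using holomorphic_on_imp_continuous_on[OF holomorphic_on_subset[OF f sub]] sub
    by (auto intro!: continuous_intros)
qed

text \<open>Complex linearity, which \<open>bounded_linear\<close>, being a notion over the reals, does not express.\<close>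

lemma cesaro_add:
  assumes "0 \<le> t" "t < 1" "f holomorphic_on ball 0 1" "g holomorphic_on ball 0 1"
  shows "cesaro t (\<lambda>z. f z + g z) = (\<lambda>z. cesaro t f z + cesaro t g z)"
proof
  fix z
  show "cesaro t (\<lambda>z. f z + g z) z = cesaro t f z + cesaro t g z"
    using contour_integral_add[OF cesaro_integrable[OF assms(1,2,3), of z]
        cesaro_integrable[OF assms(1,2,4), of z]]
    by (simp add: cesaro_def add_divide_distrib)
qed

lemma cesaro_cmult:
  assumes "0 \<le> t" "t < 1" "f holomorphic_on ball 0 1"
  shows "cesaro t (\<lambda>z. c * f z) = (\<lambda>z. c * cesaro t f z)"
proof
  fix z
  show "cesaro t (\<lambda>z. c * f z) z = c * cesaro t f z"
    using contour_integral_lmul[OF cesaro_integrable[OF assms, of z], of c]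
    by (simp add: cesaro_def)
qed

end

theory Submission
  imports Defs
begin

text \<open>
  Parametrising the segment from \<open>0\<close> to \<open>z\<close> cancels the factor \<open>1 / z\<close> and turns
  \<open>C\<^sub>t f\<close> into an average of \<open>f\<close> along the radius,
  \[ C_t f(z) = \int_0^1 \frac{f(sz)}{1 - tsz}\,ds \]
  (\<open>cesaro_eq_radial_average\<close>).
  Everything except holomorphy is read off from this formula, which also makes sense for
  \<open>|z| = 1\<close> when \<open>f\<close> is continuous on the closed disc: it then gives the continuous
  extension of \<open>C\<^sub>t f\<close> to the closed disc (\<open>continuous_on_radial_average\<close>), and since
  \<open>|1 - tsz| \<ge> 1 - ts\<close> it gives
  \[ |C_t f(z)| \le \|f\|_\infty \int_0^1 \frac{ds}{1 - ts}
       = \|f\|_\infty \, \frac{-\log(1-t)}{t} \]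
  (\<open>norm_radial_average_le\<close>), where the integral is \<open>1\<close> for \<open>t = 0\<close>. For the constant
  function \<open>1\<close> both inequalities become equalities at the boundary point \<open>z = 1\<close>; as the
  extension of \<open>C\<^sub>t 1\<close> is continuous there, its value at \<open>1\<close> is bounded by the supremum
  over the open disc, so the constant is the operator norm. Holomorphy
  (\<open>holomorphic_cesaro\<close>) holds because the integral in the definition of \<open>C\<^sub>t f\<close> is a
  primitive of a holomorphic function, normalised to vanish at \<open>0\<close>, so that \<open>C\<^sub>t f\<close> is its
  difference quotient at \<open>0\<close>.
\<close>

section \<open>Averages along radii of the closed disc\<close>

lemma norm_one_minus_ge:
  fixes w :: complex
  assumes "0 \<le> t"
  shows "1 - t * norm w \<le> norm (1 - of_real t * w)"
  using norm_triangle_ineq2[of 1 "of_real t * w"] assms by (simp add: norm_mult)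

lemma one_minus_nonzero:
  fixes w :: complex
  assumes "0 \<le> t" "t < 1" "norm w \<le> 1"
  shows "1 - of_real t * w \<noteq> 0"
proof -
  have "t * norm w \<le> t * 1"
    using assms by (intro mult_left_mono) auto
  then have "0 < norm (1 - of_real t * w)"
    using norm_one_minus_ge[of t w] assms by linarith
  then show ?thesis by (simp only: zero_less_norm_iff not_False_eq_True)
qed

lemma norm_radial_le:
  fixes z :: complex
  assumes "z \<in> cball 0 1" "s \<in> {0..1}"
  shows "norm (of_real s * z) \<le> s"
  using assms by (simp add: norm_mult mult_left_le)

definition radial_average :: "real \<Rightarrow> (complex \<Rightarrow> complex) \<Rightarrow> complex \<Rightarrow> complex" where
  "radial_average t f z =
     integral {0..1} (\<lambda>s. f (of_real s * z) / (1 - of_real t * (of_real s * z)))"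

lemma cesaro_eq_radial_average:
  assumes "z \<in> ball 0 1"
  shows "cesaro t f z = radial_average t f z"
proof (cases "z = 0")
  case True
  then show ?thesis by (simp add: cesaro_def radial_average_def)
next
  case False
  have "contour_integral (linepath 0 z) (\<lambda>\<xi>. f \<xi> / (1 - of_real t * \<xi>)) =
        integral {0..1} (\<lambda>s. f (of_real s * z) / (1 - of_real t * (of_real s * z)) * z)"
    unfolding contour_integral_integral
    by (simp add: linepath_def vector_derivative_linepath_at scaleR_conv_of_real)
  also have "\<dots> = radial_average t f z * z"
    unfolding radial_average_def by (rule integral_mult_left)
  finally show ?thesis
    using False assms by (simp add: cesaro_def)
qed

lemma continuous_on_radial_integrand:
  fixes g :: "complex \<Rightarrow> complex"
  assumes t: "0 \<le> t" "t < 1" and g: "continuous_on (cball 0 1) g"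
  shows "continuous_on (cball 0 1 \<times> {0..1})
           (\<lambda>(z, s). g (of_real s * z) / (1 - of_real t * (of_real s * z)))"
proof -
  have in_disc: "norm (of_real s * z :: complex) \<le> 1" if "z \<in> cball 0 1" "s \<in> {0..1}" for z s
    using norm_radial_le[OF that] that by simp
  have "continuous_on (cball 0 1 \<times> {0..1}) (\<lambda>p. g (of_real (snd p) * fst p))"
    by (rule continuous_on_compose2[OF g]) (use in_disc in \<open>auto intro!: continuous_intros\<close>)
  then show ?thesis
    unfolding split_beta
    using one_minus_nonzero[OF t in_disc]
    by (intro continuous_intros ballI) auto
qed

lemma continuous_on_radial_average:
  assumes "0 \<le> t" "t < 1" "continuous_on (cball 0 1) g"
  shows "continuous_on (cball 0 1) (radial_average t g)"
  using integral_continuous_on_param[of "cball 0 1" 0 1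
      "\<lambda>z s. g (of_real s * z) / (1 - of_real t * (of_real s * z))"]
    continuous_on_radial_integrand[OF assms]
  unfolding radial_average_def by simp

lemma radial_average_integrable:
  fixes g :: "complex \<Rightarrow> complex"
  assumes "0 \<le> t" "t < 1" "continuous_on (cball 0 1) g" "z \<in> cball 0 1"
  shows "(\<lambda>s. g (of_real s * z) / (1 - of_real t * (of_real s * z))) integrable_on {0..1}"
proof (rule integrable_continuous_interval)
  have "continuous_on {0..1} (\<lambda>s. (\<lambda>(z, s). g (of_real s * z) /
          (1 - of_real t * (of_real s * z))) (z, s))"
    by (rule continuous_on_compose2[OF continuous_on_radial_integrand[OF assms(1-3)]])
      (use assms(4) in \<open>auto intro!: continuous_intros\<close>)
  then show "continuous_on {0..1}
      (\<lambda>s. g (of_real s * z) / (1 - of_real t * (of_real s * z)))"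
    by simp
qed

lemma radial_average_cong:
  assumes "\<And>w. w \<in> ball 0 1 \<Longrightarrow> f w = g w" "z \<in> ball 0 1"
  shows "radial_average t f z = radial_average t g z"
  unfolding radial_average_def
proof (rule integral_cong)
  fix s :: real assume s: "s \<in> {0..1}"
  have "s * norm z \<le> 1 * norm z"
    using s by (intro mult_right_mono) auto
  then have "of_real s * z \<in> ball 0 1"
    using s assms(2) by (simp add: norm_mult)
  then show "f (of_real s * z) / (1 - of_real t * (of_real s * z)) =
             g (of_real s * z) / (1 - of_real t * (of_real s * z))"
    using assms(1) by simp
qed

section \<open>Invariance of the disc algebra\<close>

text \<open>
  The difference quotient at \<open>0\<close> of a holomorphic function, filled in with the derivative,
  is holomorphic. Here the function is a primitive \<open>P\<close> of \<open>f(\<xi>) / (1 - t\<xi>)\<close>, whose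
  derivative at \<open>0\<close> is \<open>f 0\<close>, in agreement with the value of \<open>C\<^sub>t f\<close> at \<open>0\<close>.
\<close>

lemma holomorphic_cesaro:
  assumes t: "0 \<le> t" "t < 1" and f: "f holomorphic_on ball 0 1"
  shows "cesaro t f holomorphic_on ball 0 1"
proof -
  let ?h = "\<lambda>\<xi>. f \<xi> / (1 - of_real t * \<xi>)"
  have "?h holomorphic_on ball 0 1"
    using one_minus_nonzero[OF t] by (intro holomorphic_intros f) auto
  then obtain P where P: "\<And>z. z \<in> ball 0 1 \<Longrightarrow> (P has_field_derivative ?h z) (at z within ball 0 1)"
    using holomorphic_convex_primitive'[of "ball 0 1" ?h] by auto
  have "P holomorphic_on ball 0 1"
    unfolding holomorphic_on_def field_differentiable_def using P by blast
  then have quotient: "(\<lambda>z. if z = 0 then deriv P 0 else (P z - P 0) / (z - 0))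
      holomorphic_on ball 0 1"
    by (rule pole_lemma) simp
  have "deriv P 0 = f 0"
    using P[of 0] at_within_open[of "0::complex" "ball 0 1"] by (auto intro!: DERIV_imp_deriv)
  moreover have "contour_integral (linepath 0 z) ?h = P z - P 0" if z: "z \<in> ball 0 1" for z
  proof -
    have "path_image (linepath 0 z) \<subseteq> ball 0 1"
      using z by (simp add: closed_segment_subset)
    then show ?thesis
      using contour_integral_primitive[OF P, of "linepath 0 z"]
      by (auto intro: contour_integral_unique)
  qed
  ultimately show ?thesis
    using quotient by (elim holomorphic_transform) (auto simp: cesaro_def)
qed

lemma cesaro_in_disc_algebra:
  assumes t: "0 \<le> t" "t < 1" and f: "f \<in> disc_algebra"
  shows "cesaro t f \<in> disc_algebra"
proof -
  obtain g where g: "continuous_on (cball 0 1) g" "\<And>z. z \<in> ball 0 1 \<Longrightarrow> g z = f z"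
    using f unfolding disc_algebra_def by blast
  have "radial_average t g z = cesaro t f z" if "z \<in> ball 0 1" for z
    using radial_average_cong[of g f z t] g(2) that
    by (simp add: cesaro_eq_radial_average)
  then show ?thesis
    using continuous_on_radial_average[OF t g(1)] holomorphic_cesaro[OF t] f
    by (auto simp: disc_algebra_def cesaro_def)
qed

section \<open>The sharp bound\<close>

text \<open>
  The value at \<open>0\<close> is the limit of \<open>- ln (1 - t) / t\<close> as \<open>t\<close> tends to \<open>0\<close>; with it the
  integral formula below covers all \<open>t\<close> in \<open>[0, 1)\<close>.
\<close>

definition cesaro_constant :: "real \<Rightarrow> real" where
  "cesaro_constant t = (if t = 0 then 1 else - ln (1 - t) / t)"

lemma has_integral_cesaro_constant:
  assumes t: "0 \<le> t" "t < 1"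
  shows "((\<lambda>s. 1 / (1 - t * s)) has_integral cesaro_constant t) {0..1}"
proof (cases "t = 0")
  case True
  then show ?thesis
    using has_integral_const_real[of "1::real" 0 1] by (simp add: cesaro_constant_def)
next
  case False
  have pos: "0 < 1 - t * s" if "s \<in> {0..1}" for s
    using t mult_left_mono[of s 1 t] that by auto
  have "((\<lambda>s. 1 / (1 - t * s)) has_integral
      (- ln (1 - t * 1) / t) - (- ln (1 - t * 0) / t)) {0..1}"
  proof (rule fundamental_theorem_of_calculus)
    fix s :: real assume s: "s \<in> {0..1}"
    show "((\<lambda>s. - ln (1 - t * s) / t) has_vector_derivative 1 / (1 - t * s))
        (at s within {0..1})"
      using pos[OF s] False
      unfolding has_real_derivative_iff_has_vector_derivative[symmetric]
      by (auto intro!: derivative_eq_intros simp: field_simps)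
  qed simp
  then show ?thesis
    using False by (simp add: cesaro_constant_def)
qed

lemma norm_radial_average_le:
  assumes t: "0 \<le> t" "t < 1" and g: "continuous_on (cball 0 1) g"
    and B: "\<And>w. w \<in> cball 0 1 \<Longrightarrow> norm (g w) \<le> B" and z: "z \<in> cball 0 1"
  shows "norm (radial_average t g z) \<le> cesaro_constant t * B"
proof -
  have bound: "((\<lambda>s. 1 / (1 - t * s) * B) has_integral cesaro_constant t * B) {0..1}"
    by (intro has_integral_mult_left has_integral_cesaro_constant t)
  have "norm (radial_average t g z) \<le> integral {0..1} (\<lambda>s. 1 / (1 - t * s) * B)"
    unfolding radial_average_def
  proof (rule integral_norm_bound_integral)
    show "(\<lambda>s. g (of_real s * z) / (1 - of_real t * (of_real s * z))) integrable_on {0..1}"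
      by (rule radial_average_integrable[OF t g z])
    show "(\<lambda>s. 1 / (1 - t * s) * B) integrable_on {0..1}"
      using bound by (rule has_integral_integrable)
    fix s :: real assume s: "s \<in> {0..1}"
    let ?w = "of_real s * z"
    have w: "norm ?w \<le> s" by (rule norm_radial_le[OF z s])
    have "t * norm ?w \<le> t * s" using t w by (intro mult_left_mono)
    then have le: "1 - t * s \<le> norm (1 - of_real t * ?w)"
      using norm_one_minus_ge[OF t(1), of ?w] by linarith
    have pos: "0 < 1 - t * s"
      using t mult_left_mono[of s 1 t] s by auto
    have gw: "norm (g ?w) \<le> B" using B[of ?w] w s by simp
    have "norm (g ?w / (1 - of_real t * ?w)) \<le> B / (1 - t * s)"
      unfolding norm_divide using gw le pos by (intro frac_le) (auto intro: order_trans[OF norm_ge_zero])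
    then show "norm (g ?w / (1 - of_real t * ?w)) \<le> 1 / (1 - t * s) * B" by simp
  qed
  then show ?thesis using bound by (simp add: integral_unique)
qed

lemma radial_average_one_at_one:
  assumes "0 \<le> t" "t < 1"
  shows "radial_average t (\<lambda>_. 1) 1 = of_real (cesaro_constant t)"
proof -
  have "((\<lambda>s. of_real (1 / (1 - t * s)) :: complex) has_integral
      of_real (cesaro_constant t)) {0..1}"
    by (intro has_integral_of_real has_integral_cesaro_constant assms)
  then show ?thesis
    unfolding radial_average_def by (intro integral_unique) simp
qed

text \<open>
  Since the open disc is dense in the closed one, the supremum norm also controls the
  boundary values, in particular the value at \<open>1\<close> that decides the operator norm.
\<close>

lemma norm_le_of_continuous_extension:
  assumes "continuous_on (cball 0 1) g" "\<And>z. z \<in> ball 0 1 \<Longrightarrow> g z = apply_disc f z"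
    and "z \<in> cball 0 1"
  shows "norm (g z) \<le> norm f"
  by (rule continuous_on_closure_norm_le[where s = "ball 0 1" and f = g])
    (use assms norm_apply_disc_le in auto)

section \<open>The operator on the Banach space\<close>

lemma apply_cesaro_disc:
  assumes "0 \<le> t" "t < 1"
  shows "apply_disc (cesaro_disc t f) = cesaro t (apply_disc f)"
  unfolding cesaro_disc_def
  by (intro Disc_inverse cesaro_in_disc_algebra assms apply_disc)

lemma holomorphic_apply_disc: "apply_disc f holomorphic_on ball 0 1"
  using apply_disc[of f] by (simp add: disc_algebra_def)

lemma apply_cesaro_disc_extension:
  assumes t: "0 \<le> t" "t < 1" and g: "\<And>z. z \<in> ball 0 1 \<Longrightarrow> g z = apply_disc f z"
    and z: "z \<in> ball 0 1"
  shows "radial_average t g z = apply_disc (cesaro_disc t f) z"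
  using radial_average_cong[of g "apply_disc f" z t] g z
  by (simp add: apply_cesaro_disc[OF t] cesaro_eq_radial_average)

lemma norm_cesaro_disc_le:
  assumes t: "0 \<le> t" "t < 1"
  shows "norm (cesaro_disc t f) \<le> cesaro_constant t * norm f"
proof (rule norm_disc_alg_le)
  fix z :: complex assume z: "z \<in> ball 0 1"
  obtain g where g: "continuous_on (cball 0 1) g" "\<And>z. z \<in> ball 0 1 \<Longrightarrow> g z = apply_disc f z"
    using apply_disc[of f] unfolding disc_algebra_def by blast
  have "norm (radial_average t g z) \<le> cesaro_constant t * norm f"
    using z by (intro norm_radial_average_le t g(1) norm_le_of_continuous_extension[OF g]) auto
  then show "norm (apply_disc (cesaro_disc t f) z) \<le> cesaro_constant t * norm f"
    using apply_cesaro_disc_extension[of t g f z] t g(2) z by simp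
qed

lemma bounded_linear_cesaro_disc:
  assumes t: "0 \<le> t" "t < 1"
  shows "bounded_linear (cesaro_disc t)"
proof (rule bounded_linear_intro[where K = "cesaro_constant t"])
  fix f g :: disc_alg and r :: real
  have "cesaro t (apply_disc (f + g)) =
      (\<lambda>z. cesaro t (apply_disc f) z + cesaro t (apply_disc g) z)"
    unfolding plus_disc_alg.rep_eq by (intro cesaro_add t holomorphic_apply_disc)
  then have "apply_disc (cesaro_disc t (f + g)) = apply_disc (cesaro_disc t f + cesaro_disc t g)"
    by (simp add: apply_cesaro_disc[OF t] plus_disc_alg.rep_eq)
  then show "cesaro_disc t (f + g) = cesaro_disc t f + cesaro_disc t g"
    by (simp add: apply_disc_inject)
  have "cesaro t (apply_disc (r *\<^sub>R f)) = (\<lambda>z. of_real r * cesaro t (apply_disc f) z)"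
    unfolding scaleR_disc_alg.rep_eq scaleR_conv_of_real
    by (intro cesaro_cmult t holomorphic_apply_disc)
  then have "apply_disc (cesaro_disc t (r *\<^sub>R f)) = apply_disc (r *\<^sub>R cesaro_disc t f)"
    by (simp add: apply_cesaro_disc[OF t] scaleR_disc_alg.rep_eq scaleR_conv_of_real)
  then show "cesaro_disc t (r *\<^sub>R f) = r *\<^sub>R cesaro_disc t f"
    by (simp add: apply_disc_inject)
  show "norm (cesaro_disc t f) \<le> norm f * cesaro_constant t"
    using norm_cesaro_disc_le[OF t, of f] by (simp add: mult.commute)
qed

text \<open>
  The lower bound comes from the constant function \<open>1\<close>: on the radius ending at \<open>1\<close> the
  integrand \<open>1 / (1 - ts)\<close> is exactly the majorant used for the upper bound.
\<close>

lemma onorm_cesaro_disc: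
  assumes t: "0 \<le> t" "t < 1"
  shows "onorm (cesaro_disc t) = cesaro_constant t"
proof (rule antisym)
  show "onorm (cesaro_disc t) \<le> cesaro_constant t"
  proof (rule onorm_bound)
    show "0 \<le> cesaro_constant t"
      by (rule has_integral_nonneg[OF has_integral_cesaro_constant[OF t]])
        (use t in \<open>auto simp: mult_le_one\<close>)
  qed (rule norm_cesaro_disc_le[OF t])
next
  define e where "e = Disc (\<lambda>z. if z \<in> ball 0 1 then 1 else 0)"
  have e: "1 = apply_disc e z" if "z \<in> ball 0 1" for z
    using that unfolding e_def Disc_inverse[OF disc_algebra_const] by simp
  have "norm (radial_average t (\<lambda>_. 1) 1) \<le> norm (cesaro_disc t e)"
    by (intro norm_le_of_continuous_extension continuous_on_radial_average t
        apply_cesaro_disc_extension e) auto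
  also have "\<dots> \<le> onorm (cesaro_disc t) * norm e"
    by (intro onorm bounded_linear_cesaro_disc t)
  also have "\<dots> \<le> onorm (cesaro_disc t) * 1"
    by (intro mult_left_mono onorm_pos_le bounded_linear_cesaro_disc t norm_disc_alg_le)
      (simp add: e[symmetric])
  finally show "cesaro_constant t \<le> onorm (cesaro_disc t)"
    by (simp add: radial_average_one_at_one[OF t])
qed

theorem proposition2p1:
  shows "(\<forall>t::real. 0 \<le> t \<and> t < 1 \<longrightarrow>
            (\<forall>f\<in>disc_algebra. cesaro t f \<in> disc_algebra) \<and> bounded_linear (cesaro_disc t)) \<and>
         onorm (cesaro_disc 0) = 1 \<and>
         (\<forall>t::real. 0 < t \<and> t < 1 \<longrightarrow> onorm (cesaro_disc t) = - ln (1 - t) / t)"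
  using cesaro_in_disc_algebra bounded_linear_cesaro_disc onorm_cesaro_disc
  by (simp add: cesaro_constant_def)

end
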